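(* Let $w\colon \mathbb{N}\rightarrow \mathbb{R}$ be a nonnegative function. Then the $w$-Ornstein-Uhlenbeck semigroup $P^w =(P^w_t)_{t\geq 0}$ is a Markov semigroup on $L^2(\Omega)$, namely for all $t\geq 0$ it holds that $$0\leq P^w_t\xi \leq 1\quad \mathbb{P}\text{-a.e.}$$ whenever $\xi\in L^2(\Omega)$ with $0\leq \xi \leq 1$ $\mathbb{P}$-a.e.
   Context: $\mathbb{N}$ denotes the set of nonnegative integers and $\Gamma$ the set of all finite subsets of $\mathbb{N}$ (including $\emptyset$). Let $\Omega=\{-1,1\}^{\mathbb{N}}$, let $\zeta_n(\omega)=\omega(n)$ ($n\geq 0$) be the canonical projections, and let $\mathscr{F}$ be the $\sigma$-field on $\Omega$ generated by $(\zeta_n)_{n\geq 0}$. Let $(p_n)_{n\geq 0}$ be a given sequence with $0<p_n<1$ for all $n$, and put $q_n=1-p_n$. Let $\mathbb{P}$ be the unique probability measure on $\mathscr{F}$ under which the $\zeta_n$ are independent with $\mathbb{P}\{\zeta_n=1\}=p_n$, $\mathbb{P}\{\zeta_n=-1\}=q_n$. Set $Z_n = \dfrac{\zeta_n+q_n-p_n}{2\sqrt{p_nq_n}}$, $Z_\emptyset=1$, and $Z_\sigma=\prod_{j\in\sigma}Z_j$ for nonempty $\sigma\in\Gamma$. $L^2(\Omega)=L^2(\Omega,\mathscr{F},\mathbb{P})$ is the real Hilbert space of square integrable random variables, with inner product $\langle\cdot,\cdot\rangle$ and norm $\|\cdot\|$. It is known that $\{Z_\sigma\mid\sigma\in\Gamma\}$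 is an orthonormal basis of $L^2(\Omega)$. For a nonnegative function $w\colon\mathbb{N}\to\mathbb{R}$, $\#_w(\sigma)=\sum_{j\in\sigma}w(j)$ for $\sigma\in\Gamma$, with $\#_w(\emptyset)=0$. The $w$-Ornstein-Uhlenbeck semigroup on $L^2(\Omega)$ is the strongly continuous semigroup of contraction operators $P^w=(P^w_t)_{t\geq0}$ defined by $$P^w_t\xi=\sum_{\sigma\in\Gamma}e^{-t\#_w(\sigma)}\langle Z_\sigma,\xi\rangle Z_\sigma,\quad \xi\in L^2(\Omega).$$ *)

theory Defs
  imports "HOL-Probability.Probability"
begin

text \<open>The law of \<open>\<zeta>\<^sub>n\<close> lives on the two-point space \<open>{-1, 1}\<close> rather than on all of
  \<open>real\<close>, so the product measure below has \<open>space = {-1, 1}\<^sup>\<nat>\<close> and its \<open>\<sigma>\<close>-algebra is the one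
  generated by the coordinates.\<close>

definition sign_measure :: "real \<Rightarrow> real measure" where
  "sign_measure a = point_measure {-1, 1} (\<lambda>x. ennreal (if x = 1 then a else 1 - a))"

definition bernoulli_space :: "(nat \<Rightarrow> real) \<Rightarrow> (nat \<Rightarrow> real) measure" where
  "bernoulli_space p = PiM UNIV (\<lambda>n. sign_measure (p n))"

definition \<zeta> :: "nat \<Rightarrow> (nat \<Rightarrow> real) \<Rightarrow> real" where
  "\<zeta> n \<omega> = \<omega> n"

definition Z :: "(nat \<Rightarrow> real) \<Rightarrow> nat \<Rightarrow> (nat \<Rightarrow> real) \<Rightarrow> real" where
  "Z p n \<omega> = (let q = 1 - p n in (\<zeta> n \<omega> + q - p n) / (2 * sqrt (p n * q)))"

definition \<Gamma> :: "nat set set" where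
  "\<Gamma> = {\<sigma>. finite \<sigma>}"

definition Zprod :: "(nat \<Rightarrow> real) \<Rightarrow> nat set \<Rightarrow> (nat \<Rightarrow> real) \<Rightarrow> real" where
  "Zprod p \<sigma> \<omega> = (\<Prod>j\<in>\<sigma>. Z p j \<omega>)"

text \<open>Elements of \<open>L\<^sup>2(M)\<close> are represented by functions; equality in \<open>L\<^sup>2(M)\<close> is equality
  almost everywhere.\<close>

definition L2 :: "'a measure \<Rightarrow> ('a \<Rightarrow> real) set" where
  "L2 M = {f \<in> borel_measurable M. integrable M (\<lambda>x. (f x)\<^sup>2)}"

definition L2_inner :: "'a measure \<Rightarrow> ('a \<Rightarrow> real) \<Rightarrow> ('a \<Rightarrow> real) \<Rightarrow> real" where
  "L2_inner M f g = (\<integral>x. f x * g x \<partial>M)"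

definition L2_norm :: "'a measure \<Rightarrow> ('a \<Rightarrow> real) \<Rightarrow> real" where
  "L2_norm M f = sqrt (L2_inner M f f)"

text \<open>Unconditional convergence in \<open>L\<^sup>2(M)\<close>, the analogue of \<^const>\<open>has_sum\<close>. The sum is determined
  only up to a null set, and \<open>L2_infsum\<close> picks some representative.\<close>

definition L2_has_sum :: "'a measure \<Rightarrow> ('i \<Rightarrow> 'a \<Rightarrow> real) \<Rightarrow> 'i set \<Rightarrow> ('a \<Rightarrow> real) \<Rightarrow> bool" where
  "L2_has_sum M f A s \<longleftrightarrow> s \<in> L2 M \<and>
     ((\<lambda>F. L2_norm M (\<lambda>x. (\<Sum>i\<in>F. f i x) - s x)) \<longlongrightarrow> 0) (finite_subsets_at_top A)"

definition L2_infsum :: "'a measure \<Rightarrow> ('i \<Rightarrow> 'a \<Rightarrow> real) \<Rightarrow> 'i set \<Rightarrow> 'a \<Rightarrow> real" where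
  "L2_infsum M f A = (SOME s. L2_has_sum M f A s)"

definition wcount :: "(nat \<Rightarrow> real) \<Rightarrow> nat set \<Rightarrow> real" where
  "wcount w \<sigma> = (\<Sum>j\<in>\<sigma>. w j)"

definition OU :: "(nat \<Rightarrow> real) \<Rightarrow> (nat \<Rightarrow> real) \<Rightarrow> real \<Rightarrow>
    ((nat \<Rightarrow> real) \<Rightarrow> real) \<Rightarrow> (nat \<Rightarrow> real) \<Rightarrow> real" where
  "OU p w t \<xi> = L2_infsum (bernoulli_space p)
     (\<lambda>\<sigma> \<omega>. exp (- t * wcount w \<sigma>) * L2_inner (bernoulli_space p) (Zprod p \<sigma>) \<xi> * Zprod p \<sigma> \<omega>) \<Gamma>"

text \<open>Under \<^term>\<open>bernoulli_space p\<close> the \<open>\<zeta>\<^sub>n\<close> are independent, equal to \<open>1\<close> with probability \<open>p\<^sub>n\<close>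
  and to \<open>-1\<close> with probability \<open>1 - p\<^sub>n\<close>.\<close>

lemma prob_space_sign_measure:
  assumes "0 < a" "a < 1"
  shows "prob_space (sign_measure a)"
  unfolding sign_measure_def
  using assms by (intro prob_space_point_measure) (auto simp flip: ennreal_plus)

lemma space_bernoulli_space: "space (bernoulli_space p) = {\<omega>. \<forall>n. \<omega> n \<in> {-1, 1}}"
  by (auto simp: bernoulli_space_def sign_measure_def space_PiM space_point_measure PiE_def Pi_def)

lemma prob_space_bernoulli_space:
  assumes "\<And>n. 0 < p n \<and> p n < 1"
  shows "prob_space (bernoulli_space p)"
  unfolding bernoulli_space_def
  by (intro prob_space_PiM prob_space_sign_measure) (use assms in auto)

lemma distr_\<zeta>:
  assumes "\<And>n. 0 < p n \<and> p n < 1"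
  shows "distr (bernoulli_space p) (sign_measure (p n)) (\<zeta> n) = sign_measure (p n)"
proof -
  have "\<zeta> n = (\<lambda>\<omega>. \<omega> n)" by (auto simp: \<zeta>_def)
  then show ?thesis
    unfolding bernoulli_space_def
    using assms distr_PiM_component[of UNIV "\<lambda>n. sign_measure (p n)" n]
    by (simp add: prob_space_sign_measure)
qed

lemma measurable_\<zeta>: "\<zeta> n \<in> measurable (bernoulli_space p) (sign_measure (p n))"
proof -
  have "\<zeta> n = (\<lambda>\<omega>. \<omega> n)" by (auto simp: \<zeta>_def)
  then show ?thesis unfolding bernoulli_space_def by simp
qed

lemma measure_\<zeta>:
  assumes p: "\<And>n. 0 < p n \<and> p n < 1"
  shows "measure (bernoulli_space p) {\<omega> \<in> space (bernoulli_space p). \<zeta> n \<omega> = 1} = p n"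
    and "measure (bernoulli_space p) {\<omega> \<in> space (bernoulli_space p). \<zeta> n \<omega> = -1} = 1 - p n"
proof -
  have *: "measure (bernoulli_space p) {\<omega> \<in> space (bernoulli_space p). \<zeta> n \<omega> = x} =
      (if x = 1 then p n else 1 - p n)" if x: "x \<in> {-1, 1}" for x
  proof -
    have "measure (bernoulli_space p) {\<omega> \<in> space (bernoulli_space p). \<zeta> n \<omega> = x} =
        measure (distr (bernoulli_space p) (sign_measure (p n)) (\<zeta> n)) {x}"
      using x by (subst measure_distr[OF measurable_\<zeta>])
        (auto simp: sign_measure_def sets_point_measure intro!: arg_cong[where f = "measure _"])
    also have "\<dots> = measure (sign_measure (p n)) {x}"
      by (simp add: distr_\<zeta> p)
    also have "\<dots> = (if x = 1 then p n else 1 - p n)"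
      using x p[of n] by (auto simp: sign_measure_def measure_def emeasure_point_measure_finite)
    finally show ?thesis .
  qed
  show "measure (bernoulli_space p) {\<omega> \<in> space (bernoulli_space p). \<zeta> n \<omega> = 1} = p n"
    and "measure (bernoulli_space p) {\<omega> \<in> space (bernoulli_space p). \<zeta> n \<omega> = -1} = 1 - p n"
    using *[of 1] *[of "-1"] by auto
qed

lemma indep_vars_\<zeta>:
  assumes p: "\<And>n. 0 < p n \<and> p n < 1"
  shows "prob_space.indep_vars (bernoulli_space p) (\<lambda>n. sign_measure (p n)) \<zeta> UNIV"
proof -
  interpret prob_space "bernoulli_space p"
    by (rule prob_space_bernoulli_space) (use p in auto)
  have eq: "(\<lambda>\<omega>. \<lambda>i\<in>UNIV. \<zeta> i \<omega>) = (\<lambda>\<omega>. \<omega>)"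
    by (auto simp: \<zeta>_def fun_eq_iff)
  have d: "distr (bernoulli_space p) (Pi\<^sub>M UNIV (\<lambda>n. sign_measure (p n))) (\<lambda>\<omega>. \<omega>) = bernoulli_space p"
    unfolding bernoulli_space_def by (rule distr_id)
  show ?thesis
    by (subst indep_vars_iff_distr_eq_PiM)
      (auto simp: measurable_\<zeta> eq d distr_\<zeta> p, simp add: bernoulli_space_def)
qed

end

theory Submission
  imports Defs
begin

text \<open>
  Write \<open>r\<^sub>j = exp (-t w\<^sub>j)\<close>, so that \<open>0 \<le> r\<^sub>j \<le> 1\<close> and the multiplier \<open>exp (-t #\<^sub>w(\<sigma>))\<close> is the
  product of the \<open>r\<^sub>j\<close> over \<open>\<sigma>\<close>. Restricted to the subsets of a finite set \<open>J\<close>, the series defining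
  the semigroup is an integral operator
  \<open>\<omega> \<mapsto> \<integral> K(\<omega>, \<eta>) \<xi>(\<eta>) d\<P>(\<eta>)\<close>, whose kernel factorises:
  \<open>K(\<omega>, \<eta>) = \<Sum>\<^bsub>\<sigma> \<subseteq> J\<^esub> r\<^sub>\<sigma> Z\<^sub>\<sigma>(\<omega>) Z\<^sub>\<sigma>(\<eta>) = \<Prod>\<^bsub>j \<in> J\<^esub> (1 + r\<^sub>j Z\<^sub>j(\<omega>) Z\<^sub>j(\<eta>))\<close>.
  The two values of \<open>Z\<^sub>j\<close> have product \<open>-1\<close>, so \<open>Z\<^sub>j(\<omega>) Z\<^sub>j(\<eta>) \<ge> -1\<close> in all cases and every factor is
  at least \<open>1 - r\<^sub>j \<ge> 0\<close>; hence \<open>K \<ge> 0\<close>. Its integral in \<open>\<eta>\<close> is \<open>1\<close>, because all \<open>Z\<^sub>\<sigma>\<close> with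
  \<open>\<sigma> \<noteq> \<emptyset>\<close> have mean zero. So this partial sum takes values in \<open>[0, 1]\<close> whenever \<open>\<xi>\<close> does
  (\<open>damped_partial_sum_bounds\<close>).

  The sets of all subsets of \<open>{0, ..., n - 1}\<close> are cofinal among the finite subsets of \<open>\<Gamma>\<close>, so these
  partial sums converge in \<open>L\<^sup>2\<close> to the value of the semigroup, and pointwise bounds survive an \<open>L\<^sup>2\<close>
  limit (\<open>L2_has_sum_AE_bounds\<close>). Convergence of the series itself follows from the inequality of
  Bessel, which makes the coefficients square summable, and the theorem of Riesz and Fischer
  (\<open>riesz_fischer\<close>); both rest on the orthonormality of the \<open>Z\<^sub>\<sigma>\<close>, a consequence of independence.
\<close>

section \<open>Square integrable functions\<close>

lemma L2_mult_integrable: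
  assumes "f \<in> L2 M" "g \<in> L2 M"
  shows "integrable M (\<lambda>x. f x * g x)"
proof -
  have [measurable]: "f \<in> borel_measurable M" "g \<in> borel_measurable M"
    using assms by (auto simp: L2_def)
  have "integrable M (\<lambda>x. (f x)\<^sup>2 + (g x)\<^sup>2)"
    using assms by (auto simp: L2_def)
  moreover have "\<bar>a * b\<bar> \<le> a\<^sup>2 + b\<^sup>2" for a b :: real
    using sum_squares_bound[of "\<bar>a\<bar>" "\<bar>b\<bar>"] abs_ge_zero[of "a * b"]
    unfolding abs_mult power2_abs by linarith
  ultimately show ?thesis
    by (elim Bochner_Integration.integrable_bound) auto
qed

lemma L2_add:
  assumes "f \<in> L2 M" "g \<in> L2 M"
  shows "(\<lambda>x. f x + g x) \<in> L2 M"
proof -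
  have "integrable M (\<lambda>x. (f x)\<^sup>2 + (g x)\<^sup>2 + 2 * (f x * g x))"
    using assms L2_mult_integrable[OF assms] by (auto simp: L2_def)
  then show ?thesis
    using assms by (auto simp: L2_def power2_sum mult.assoc)
qed

lemma L2_cmult: "f \<in> L2 M \<Longrightarrow> (\<lambda>x. c * f x) \<in> L2 M"
  by (auto simp: L2_def power_mult_distrib)

lemma L2_diff:
  assumes "f \<in> L2 M" "g \<in> L2 M"
  shows "(\<lambda>x. f x - g x) \<in> L2 M"
  using L2_add[OF assms(1) L2_cmult[OF assms(2), of "-1"]] by simp

lemma L2_sum:
  assumes "\<And>i. i \<in> F \<Longrightarrow> f i \<in> L2 M"
  shows "(\<lambda>x. \<Sum>i\<in>F. f i x) \<in> L2 M"
  using assms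
proof (induction F rule: infinite_finite_induct)
  case (insert i F)
  then show ?case using L2_add[of "f i" M "\<lambda>x. \<Sum>i\<in>F. f i x"] by simp
qed (auto simp: L2_def)

lemma L2_inner_self: "L2_inner M f f = (\<integral>x. (f x)\<^sup>2 \<partial>M)"
  by (simp add: L2_inner_def power2_eq_square)

section \<open>Orthonormal expansions\<close>

definition orthonormal_family :: "'a measure \<Rightarrow> ('i \<Rightarrow> 'a \<Rightarrow> real) \<Rightarrow> 'i set \<Rightarrow> bool" where
  "orthonormal_family M e A \<longleftrightarrow> (\<forall>i\<in>A. e i \<in> L2 M) \<and>
     (\<forall>i\<in>A. \<forall>j\<in>A. L2_inner M (e i) (e j) = (if i = j then 1 else 0))"

lemma orthonormal_family_L2_sum:
  assumes "orthonormal_family M e A" "F \<subseteq> A"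
  shows "(\<lambda>x. \<Sum>i\<in>F. c i * e i x) \<in> L2 M"
  using assms by (intro L2_sum L2_cmult) (auto simp: orthonormal_family_def)

lemma pythagoras:
  assumes e: "orthonormal_family M e A" and F: "finite F" "F \<subseteq> A"
  shows "(\<integral>x. (\<Sum>i\<in>F. c i * e i x)\<^sup>2 \<partial>M) = (\<Sum>i\<in>F. (c i)\<^sup>2)"
proof -
  have int: "integrable M (\<lambda>x. e i x * e j x)" if "i \<in> F" "j \<in> F" for i j
    using e F that by (intro L2_mult_integrable) (auto simp: orthonormal_family_def)
  have "(\<integral>x. (\<Sum>i\<in>F. c i * e i x)\<^sup>2 \<partial>M)
      = (\<integral>x. (\<Sum>i\<in>F. \<Sum>j\<in>F. (c i * c j) * (e i x * e j x)) \<partial>M)"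
    by (simp add: power2_eq_square sum_product mult_ac)
  also have "\<dots> = (\<Sum>i\<in>F. \<Sum>j\<in>F. (c i * c j) * L2_inner M (e i) (e j))"
    using int by (simp add: L2_inner_def)
  also have "\<dots> = (\<Sum>i\<in>F. \<Sum>j\<in>F. if i = j then c i * c j else 0)"
    using e F by (intro sum.cong refl) (auto simp: orthonormal_family_def subset_iff)
  also have "\<dots> = (\<Sum>i\<in>F. (c i)\<^sup>2)"
    using F by (simp add: power2_eq_square)
  finally show ?thesis .
qed

text \<open>Expand \<open>0 \<le> \<parallel>f - \<Sum>\<^bsub>i \<in> F\<^esub> \<langle>e\<^sub>i, f\<rangle> e\<^sub>i\<parallel>\<^sup>2\<close>.\<close>

lemma bessel:
  assumes e: "orthonormal_family M e A" and F: "finite F" "F \<subseteq> A" and f: "f \<in> L2 M"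
  shows "(\<Sum>i\<in>F. (L2_inner M (e i) f)\<^sup>2) \<le> L2_inner M f f"
proof -
  define a where "a i = L2_inner M (e i) f" for i
  define S where "S x = (\<Sum>i\<in>F. a i * e i x)" for x
  have S: "S \<in> L2 M"
    unfolding S_def by (rule orthonormal_family_L2_sum[OF e F(2)])
  have int: "integrable M (\<lambda>x. e i x * f x)" if "i \<in> F" for i
    using e F f that by (intro L2_mult_integrable) (auto simp: orthonormal_family_def)
  have Sf: "(\<integral>x. S x * f x \<partial>M) = (\<Sum>i\<in>F. (a i)\<^sup>2)"
  proof -
    have "(\<integral>x. S x * f x \<partial>M) = (\<integral>x. (\<Sum>i\<in>F. a i * (e i x * f x)) \<partial>M)"
      by (simp add: S_def sum_distrib_right mult.assoc)
    also have "\<dots> = (\<Sum>i\<in>F. a i * a i)"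
      using int by (simp add: a_def L2_inner_def)
    finally show ?thesis by (simp add: power2_eq_square)
  qed
  have "0 \<le> (\<integral>x. (f x - S x)\<^sup>2 \<partial>M)"
    by simp
  also have "\<dots> = (\<integral>x. (f x)\<^sup>2 + (S x)\<^sup>2 - 2 * (S x * f x) \<partial>M)"
    by (simp add: power2_diff mult_ac)
  also have "\<dots> = (\<integral>x. (f x)\<^sup>2 \<partial>M) + (\<integral>x. (S x)\<^sup>2 \<partial>M) - 2 * (\<integral>x. S x * f x \<partial>M)"
    using f S L2_mult_integrable[OF S f] by (simp add: L2_def)
  also have "(\<integral>x. (S x)\<^sup>2 \<partial>M) = (\<Sum>i\<in>F. (a i)\<^sup>2)"
    unfolding S_def by (rule pythagoras[OF e F])
  finally show ?thesis
    by (simp add: Sf a_def L2_inner_self)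
qed

lemma bessel_summable:
  assumes e: "orthonormal_family M e A" and f: "f \<in> L2 M"
  shows "(\<lambda>i. (L2_inner M (e i) f)\<^sup>2) summable_on A"
  using bessel[OF e _ _ f]
  by (intro nonneg_bounded_partial_sums_imp_summable_on[where C = "L2_inner M f f"])
     (auto intro!: eventually_finite_subsets_at_top_weakI)

text \<open>By Pythagoras the left-hand side is the sum of \<open>c\<^sub>i\<^sup>2\<close> over the symmetric difference of \<open>F\<close> and
  \<open>G\<close>. Bounding it by the two tails yields the Cauchy property without any inclusion between \<open>F\<close>
  and \<open>G\<close>.\<close>

lemma partial_sums_dist_le:
  fixes c :: "'i \<Rightarrow> real"
  assumes e: "orthonormal_family M e A" and c: "((\<lambda>i. (c i)\<^sup>2) has_sum T) A"
    and F: "finite F" "F \<subseteq> A" and G: "finite G" "G \<subseteq> A"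
  shows "(\<integral>x. ((\<Sum>i\<in>F. c i * e i x) - (\<Sum>i\<in>G. c i * e i x))\<^sup>2 \<partial>M)
       \<le> (T - (\<Sum>i\<in>F. (c i)\<^sup>2)) + (T - (\<Sum>i\<in>G. (c i)\<^sup>2))"
proof -
  define b where "b i = (if i \<in> F then c i else 0) - (if i \<in> G then c i else 0)" for i
  have b: "(\<Sum>i\<in>F. c i * e i x) - (\<Sum>i\<in>G. c i * e i x) = (\<Sum>i\<in>F \<union> G. b i * e i x)" for x
  proof -
    have "(\<Sum>i\<in>F. c i * e i x) = (\<Sum>i\<in>F \<union> G. (if i \<in> F then c i else 0) * e i x)"
      using F G by (intro sum.mono_neutral_cong_left) auto
    moreover have "(\<Sum>i\<in>G. c i * e i x) = (\<Sum>i\<in>F \<union> G. (if i \<in> G then c i else 0) * e i x)"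
      using F G by (intro sum.mono_neutral_cong_left) auto
    ultimately show ?thesis
      by (simp add: b_def left_diff_distrib sum_subtractf)
  qed
  have le: "(\<Sum>i\<in>F \<union> G. (c i)\<^sup>2) \<le> T"
    using finite_sum_le_has_sum[OF c, of "F \<union> G"] F G by auto
  have "(\<integral>x. ((\<Sum>i\<in>F. c i * e i x) - (\<Sum>i\<in>G. c i * e i x))\<^sup>2 \<partial>M) = (\<Sum>i\<in>F \<union> G. (b i)\<^sup>2)"
    unfolding b using F G by (intro pythagoras[OF e]) auto
  also have "\<dots> = (\<Sum>i\<in>(F \<union> G) - (F \<inter> G). (c i)\<^sup>2)"
    using F G by (intro sum.mono_neutral_cong_right) (auto simp: b_def)
  also have "\<dots> = (\<Sum>i\<in>F \<union> G. (c i)\<^sup>2) - (\<Sum>i\<in>F \<inter> G. (c i)\<^sup>2)"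
    using F G by (intro sum_diff) auto
  also have "\<dots> \<le> 2 * T - (\<Sum>i\<in>F \<union> G. (c i)\<^sup>2) - (\<Sum>i\<in>F \<inter> G. (c i)\<^sup>2)"
    using le by simp
  also have "\<dots> = (T - (\<Sum>i\<in>F. (c i)\<^sup>2)) + (T - (\<Sum>i\<in>G. (c i)\<^sup>2))"
    using sum.union_inter[OF F(1) G(1), of "\<lambda>i. (c i)\<^sup>2"] by simp
  finally show ?thesis .
qed

text \<open>The integral of \<open>\<Sum>\<^sub>k \<bar>f\<^sub>k\<bar>\<close> is finite by monotone convergence, so this sum is finite almost
  everywhere.\<close>

lemma AE_summable_of_summable_L1:
  fixes f :: "nat \<Rightarrow> 'a \<Rightarrow> real"
  assumes f: "\<And>k. integrable M (f k)" and sum: "summable (\<lambda>k. \<integral>x. \<bar>f k x\<bar> \<partial>M)"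
  shows "AE x in M. summable (\<lambda>k. f k x)"
proof -
  have [measurable]: "f k \<in> borel_measurable M" for k
    using f by auto
  have "(\<integral>\<^sup>+x. (\<Sum>k. ennreal \<bar>f k x\<bar>) \<partial>M) = (\<Sum>k. \<integral>\<^sup>+x. ennreal \<bar>f k x\<bar> \<partial>M)"
    by (rule nn_integral_suminf) auto
  also have "\<dots> = (\<Sum>k. ennreal (\<integral>x. \<bar>f k x\<bar> \<partial>M))"
    using f by (subst nn_integral_eq_integral) auto
  also have "\<dots> = ennreal (\<Sum>k. \<integral>x. \<bar>f k x\<bar> \<partial>M)"
    using sum by (intro suminf_ennreal2) auto
  finally have "(\<integral>\<^sup>+x. (\<Sum>k. ennreal \<bar>f k x\<bar>) \<partial>M) \<noteq> \<infinity>"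
    by simp
  then have "AE x in M. (\<Sum>k. ennreal \<bar>f k x\<bar>) \<noteq> \<infinity>"
    by (intro nn_integral_PInf_AE) auto
  then show ?thesis
  proof eventually_elim
    case (elim x)
    then have "summable (\<lambda>k. \<bar>f k x\<bar>)"
      by (intro summable_suminf_not_top) auto
    then show ?case by (rule summable_rabs_cancel)
  qed
qed

text \<open>A sequence whose \<open>L\<^sup>2\<close> increments decay geometrically also has summable \<open>L\<^sup>1\<close> increments, since
  the measure is finite; hence it converges almost everywhere. This supplies the pointwise limit in
  the theorem of Riesz and Fischer.\<close>

lemma (in prob_space) AE_convergent_of_summable_L2:
  fixes S :: "nat \<Rightarrow> 'a \<Rightarrow> real"
  assumes S: "\<And>k. S k \<in> L2 M"
    and le: "\<And>k. (\<integral>x. (S (Suc k) x - S k x)\<^sup>2 \<partial>M) \<le> 2 * (1/4)^k"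
  shows "AE x in M. convergent (\<lambda>k. S k x)"
proof -
  define D where "D k x = S (Suc k) x - S k x" for k x
  have D: "D k \<in> L2 M" for k
    unfolding D_def by (intro L2_diff S)
  have D1: "integrable M (D k)" for k
    using L2_mult_integrable[OF D[of k], of "\<lambda>_. 1"] by (simp add: L2_def)
  \<comment> \<open>Arithmetic-geometric mean, with weights chosen so that both terms integrate to at most a
      constant times \<open>2\<^sup>-\<^sup>k\<close>.\<close>
  have "\<bar>D k x\<bar> \<le> (1/2)^k + 2^k * (D k x)\<^sup>2" for k x
  proof -
    have "2 * \<bar>D k x\<bar> \<le> (1/2)^k + 2^k * (D k x)\<^sup>2"
      using zero_le_power2[of "1 - 2^k * \<bar>D k x\<bar>"]
      by (simp add: field_simps power2_eq_square)
    then show ?thesis by simp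
  qed
  then have "(\<integral>x. \<bar>D k x\<bar> \<partial>M) \<le> (\<integral>x. (1/2)^k + 2^k * (D k x)\<^sup>2 \<partial>M)" for k
    using D1 D by (intro integral_mono) (auto simp: L2_def)
  also have "(\<integral>x. (1/2)^k + 2^k * (D k x)\<^sup>2 \<partial>M) = (1/2)^k + 2^k * (\<integral>x. (D k x)\<^sup>2 \<partial>M)" for k
    using D by (simp add: L2_def prob_space)
  also have "(1/2)^k + 2^k * (\<integral>x. (D k x)\<^sup>2 \<partial>M) \<le> (1/2)^k + 2^k * (2 * (1/4)^k)" for k
    using le[of k] by (intro add_left_mono mult_left_mono) (auto simp: D_def)
  also have "(1/2)^k + 2^k * (2 * (1/4)^k) = 3 * (1/2::real)^k" for k
  proof -
    have "2^k * (1/4::real)^k = (1/2)^k"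
      by (simp flip: power_mult_distrib)
    then show ?thesis by simp
  qed
  finally have "(\<integral>x. \<bar>D k x\<bar> \<partial>M) \<le> 3 * (1/2)^k" for k .
  then have "summable (\<lambda>k. \<integral>x. \<bar>D k x\<bar> \<partial>M)"
    by (intro summable_comparison_test[OF _ summable_mult[OF summable_geometric[of "1/2"]]]) auto
  from AE_summable_of_summable_L1[OF D1 this] show ?thesis
  proof eventually_elim
    case (elim x)
    have "(\<lambda>n. \<Sum>k<n. D k x) = (\<lambda>n. S n x - S 0 x)"
      unfolding D_def by (rule ext, rule sum_lessThan_telescope)
    with elim have "convergent (\<lambda>n. S n x - S 0 x)"
      by (simp add: summable_iff_convergent)
    then show ?case by (simp add: convergent_diff_const_right_iff)
  qed
qed

text \<open>The index set may be arbitrary: square summability provides finite sets \<open>G\<^sub>k\<close> with tails below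
  \<open>4\<^sup>-\<^sup>k\<close>, and the partial sums over them converge almost everywhere to some \<open>s\<close>. Passing to the limit
  \<open>k \<rightarrow> \<infinity>\<close> in \<open>partial_sums_dist_le\<close> by means of the lemma of Fatou bounds the distance
  from \<open>s\<close> to the partial sum over any finite \<open>F\<close> by the tail of \<open>F\<close>; this is convergence along the
  whole net of finite sets.\<close>

lemma (in prob_space) riesz_fischer:
  fixes c :: "'i \<Rightarrow> real"
  assumes e: "orthonormal_family M e A" and c: "(\<lambda>i. (c i)\<^sup>2) summable_on A"
  obtains s where "L2_has_sum M (\<lambda>i x. c i * e i x) A s"
proof -
  define S where "S F x = (\<Sum>i\<in>F. c i * e i x)" for F x
  obtain T where T: "((\<lambda>i. (c i)\<^sup>2) has_sum T) A"
    using c by (auto simp: summable_on_def)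
  have lim: "((\<lambda>F. T - (\<Sum>i\<in>F. (c i)\<^sup>2)) \<longlongrightarrow> 0) (finite_subsets_at_top A)"
    using tendsto_diff[OF tendsto_const[of T] T[unfolded has_sum_def]] by simp
  have S_L2: "S F \<in> L2 M" if "F \<subseteq> A" for F
    unfolding S_def by (rule orthonormal_family_L2_sum[OF e that])
  have "\<exists>G. finite G \<and> G \<subseteq> A \<and> T - (\<Sum>i\<in>G. (c i)\<^sup>2) < (1/4)^k" for k :: nat
  proof -
    have "\<forall>\<^sub>F F in finite_subsets_at_top A. T - (\<Sum>i\<in>F. (c i)\<^sup>2) < (1/4)^k"
      by (rule order_tendstoD(2)[OF lim]) simp
    then show ?thesis by (auto simp: eventually_finite_subsets_at_top)
  qed
  then obtain G where G: "finite (G k)" "G k \<subseteq> A" "T - (\<Sum>i\<in>G k. (c i)\<^sup>2) < (1/4)^k" for k :: nat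
    by metis
  have dist: "(\<integral>x. (S F x - S (G k) x)\<^sup>2 \<partial>M) \<le> (T - (\<Sum>i\<in>F. (c i)\<^sup>2)) + (1/4)^k"
    if F: "finite F" "F \<subseteq> A" for F k
    using partial_sums_dist_le[OF e T F G(1,2)[of k]] G(3)[of k] by (simp add: S_def)
  have "(\<integral>x. (S (G (Suc k)) x - S (G k) x)\<^sup>2 \<partial>M) \<le> 2 * (1/4)^k" for k
  proof -
    have "(\<integral>x. (S (G (Suc k)) x - S (G k) x)\<^sup>2 \<partial>M) \<le> (1/4)^(Suc k) + (1/4)^k"
      using dist[OF G(1,2)[of "Suc k"], of k] G(3)[of "Suc k"] by simp
    also have "\<dots> \<le> 2 * (1/4)^k" by simp
    finally show ?thesis .
  qed
  then have conv: "AE x in M. convergent (\<lambda>k. S (G k) x)"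
    by (intro AE_convergent_of_summable_L2 S_L2 G)
  define s where "s x = lim (\<lambda>k. S (G k) x)" for x
  have S_meas: "S F \<in> borel_measurable M" if "F \<subseteq> A" for F
    using S_L2[OF that] by (auto simp: L2_def)
  have SG_meas [measurable]: "S (G k) \<in> borel_measurable M" for k
    by (rule S_meas[OF G(2)])
  have s_meas [measurable]: "s \<in> borel_measurable M"
    unfolding s_def by (rule borel_measurable_lim_metric) measurable
  have fatou: "(\<integral>\<^sup>+x. ennreal ((S F x - s x)\<^sup>2) \<partial>M) \<le> ennreal (T - (\<Sum>i\<in>F. (c i)\<^sup>2))"
    if F: "finite F" "F \<subseteq> A" for F
  proof -
    note [measurable] = S_meas[OF F(2)]
    have "AE x in M. ennreal ((S F x - s x)\<^sup>2) = liminf (\<lambda>k. ennreal ((S F x - S (G k) x)\<^sup>2))"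
      using conv
    proof eventually_elim
      case (elim x)
      then have "(\<lambda>k. S (G k) x) \<longlonglongrightarrow> s x"
        by (simp add: s_def convergent_LIMSEQ_iff)
      then have "(\<lambda>k. ennreal ((S F x - S (G k) x)\<^sup>2)) \<longlonglongrightarrow> ennreal ((S F x - s x)\<^sup>2)"
        by (intro tendsto_intros)
      then show ?case
        by (rule lim_imp_Liminf[OF trivial_limit_sequentially, symmetric])
    qed
    then have "(\<integral>\<^sup>+x. ennreal ((S F x - s x)\<^sup>2) \<partial>M)
        = (\<integral>\<^sup>+x. liminf (\<lambda>k. ennreal ((S F x - S (G k) x)\<^sup>2)) \<partial>M)"
      by (rule nn_integral_cong_AE)
    also have "\<dots> \<le> liminf (\<lambda>k. \<integral>\<^sup>+x. ennreal ((S F x - S (G k) x)\<^sup>2) \<partial>M)"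
      by (rule nn_integral_liminf) measurable
    also have "\<dots> \<le> liminf (\<lambda>k. ennreal ((T - (\<Sum>i\<in>F. (c i)\<^sup>2)) + (1/4)^k))"
    proof (intro Liminf_mono always_eventually allI)
      fix k
      have "(\<integral>\<^sup>+x. ennreal ((S F x - S (G k) x)\<^sup>2) \<partial>M) = ennreal (\<integral>x. (S F x - S (G k) x)\<^sup>2 \<partial>M)"
        using L2_diff[OF S_L2[OF F(2)] S_L2[OF G(2)[of k]]]
        by (intro nn_integral_eq_integral) (auto simp: L2_def)
      then show "(\<integral>\<^sup>+x. ennreal ((S F x - S (G k) x)\<^sup>2) \<partial>M)
          \<le> ennreal ((T - (\<Sum>i\<in>F. (c i)\<^sup>2)) + (1/4)^k)"
        using dist[OF F, of k] by (simp add: ennreal_leI)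
    qed
    also have "\<dots> = ennreal ((T - (\<Sum>i\<in>F. (c i)\<^sup>2)) + 0)"
      by (intro lim_imp_Liminf tendsto_ennrealI tendsto_intros LIMSEQ_realpow_zero) auto
    finally show ?thesis by simp
  qed
  have int: "integrable M (\<lambda>x. (S F x - s x)\<^sup>2)" if F: "finite F" "F \<subseteq> A" for F
    using S_meas[OF F(2)] fatou[OF F]
    by (intro integrableI_bounded) (auto simp: le_less_trans)
  \<comment> \<open>The empty partial sum is \<open>0\<close>, so the bound for \<open>F = {}\<close> is square integrability of \<open>s\<close>.\<close>
  have s_L2: "s \<in> L2 M"
    using int[of "{}"] s_meas by (simp add: S_def L2_def)
  have norm_le: "L2_norm M (\<lambda>x. S F x - s x) \<le> sqrt (T - (\<Sum>i\<in>F. (c i)\<^sup>2))"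
    if F: "finite F" "F \<subseteq> A" for F
  proof -
    have "(\<Sum>i\<in>F. (c i)\<^sup>2) \<le> T"
      using F by (intro finite_sum_le_has_sum[OF T]) auto
    then have "(\<integral>x. (S F x - s x)\<^sup>2 \<partial>M) \<le> T - (\<Sum>i\<in>F. (c i)\<^sup>2)"
      using fatou[OF F] int[OF F] by (subst (asm) nn_integral_eq_integral) auto
    then show ?thesis by (simp add: L2_norm_def L2_inner_self)
  qed
  have "((\<lambda>F. L2_norm M (\<lambda>x. S F x - s x)) \<longlongrightarrow> 0) (finite_subsets_at_top A)"
  proof (rule tendsto_sandwich[OF _ _ tendsto_const])
    show "((\<lambda>F. sqrt (T - (\<Sum>i\<in>F. (c i)\<^sup>2))) \<longlongrightarrow> 0) (finite_subsets_at_top A)"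
      using tendsto_real_sqrt[OF lim] by simp
    show "\<forall>\<^sub>F F in finite_subsets_at_top A.
        L2_norm M (\<lambda>x. S F x - s x) \<le> sqrt (T - (\<Sum>i\<in>F. (c i)\<^sup>2))"
      by (rule eventually_finite_subsets_at_top_weakI) (rule norm_le)
    show "\<forall>\<^sub>F F in finite_subsets_at_top A. 0 \<le> L2_norm M (\<lambda>x. S F x - s x)"
      by (simp add: L2_norm_def L2_inner_self)
  qed
  then have "L2_has_sum M (\<lambda>i x. c i * e i x) A s"
    using s_L2 by (simp add: L2_has_sum_def S_def)
  then show ?thesis by (rule that)
qed

lemma L2_has_sum_infsum:
  assumes "L2_has_sum M f A s"
  shows "L2_has_sum M f A (L2_infsum M f A)"
  unfolding L2_infsum_def using assms by (rule someI[where P = "L2_has_sum M f A"])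

text \<open>Let \<open>d\<close> be the difference of \<open>s\<close> and its truncation to \<open>[a, b]\<close>, the nearest point of that
  interval. Then \<open>\<bar>d\<bar>\<close> is at most the distance from \<open>s\<close> to any partial sum with values in \<open>[a, b]\<close>, so its
  \<open>L\<^sup>2\<close> norm is zero. One cofinal sequence of such partial sums is enough.\<close>

lemma L2_has_sum_AE_bounds:
  fixes a b :: real
  assumes s: "L2_has_sum M f A s" and ab: "a \<le> b"
    and f: "\<And>i. i \<in> A \<Longrightarrow> f i \<in> L2 M"
    and B: "filterlim B (finite_subsets_at_top A) sequentially" "\<And>n. B n \<subseteq> A"
    and bnd: "\<And>n::nat. AE x in M. a \<le> (\<Sum>i\<in>B n. f i x) \<and> (\<Sum>i\<in>B n. f i x) \<le> b"
  shows "AE x in M. a \<le> s x \<and> s x \<le> b"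
proof -
  define d where "d x = s x - max a (min b (s x))" for x
  have s_L2: "s \<in> L2 M"
    using s by (simp add: L2_has_sum_def)
  then have [measurable]: "s \<in> borel_measurable M"
    by (simp add: L2_def)
  have [measurable]: "d \<in> borel_measurable M"
    unfolding d_def by measurable
  define I where "I n = (\<integral>x. ((\<Sum>i\<in>B n. f i x) - s x)\<^sup>2 \<partial>M)" for n
  have diff: "(\<lambda>x. (\<Sum>i\<in>B n. f i x) - s x) \<in> L2 M" for n
    using B(2)[of n] f s_L2 by (intro L2_diff L2_sum) auto
  have dist: "AE x in M. (d x)\<^sup>2 \<le> ((\<Sum>i\<in>B n. f i x) - s x)\<^sup>2" for n
    using bnd[of n]
  proof eventually_elim
    case (elim x)
    then have "\<bar>d x\<bar> \<le> \<bar>(\<Sum>i\<in>B n. f i x) - s x\<bar>"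
      using ab by (auto simp: d_def max_def min_def)
    then show ?case by (simp add: abs_le_square_iff)
  qed
  have d_le: "(\<integral>\<^sup>+x. ennreal ((d x)\<^sup>2) \<partial>M) \<le> ennreal (I n)" for n
  proof -
    have "(\<integral>\<^sup>+x. ennreal ((d x)\<^sup>2) \<partial>M) \<le> (\<integral>\<^sup>+x. ennreal (((\<Sum>i\<in>B n. f i x) - s x)\<^sup>2) \<partial>M)"
      using dist[of n] by (intro nn_integral_mono_AE) (auto intro: ennreal_leI)
    also have "\<dots> = ennreal (I n)"
      unfolding I_def using diff[of n] by (intro nn_integral_eq_integral) (auto simp: L2_def)
    finally show ?thesis .
  qed
  have "(\<lambda>n. (L2_norm M (\<lambda>x. (\<Sum>i\<in>B n. f i x) - s x))\<^sup>2) \<longlonglongrightarrow> 0\<^sup>2"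
    using s by (intro tendsto_power filterlim_compose[OF _ B(1)]) (auto simp: L2_has_sum_def)
  then have "I \<longlonglongrightarrow> 0"
    by (simp add: I_def[abs_def] L2_norm_def L2_inner_self)
  then have "(\<lambda>n. ennreal (I n)) \<longlonglongrightarrow> ennreal 0"
    by (rule tendsto_ennrealI)
  then have "(\<integral>\<^sup>+x. ennreal ((d x)\<^sup>2) \<partial>M) \<le> ennreal 0"
    using d_le by (intro LIMSEQ_le_const) auto
  then have "(\<integral>\<^sup>+x. ennreal ((d x)\<^sup>2) \<partial>M) = 0"
    by simp
  then have "AE x in M. ennreal ((d x)\<^sup>2) = 0"
    by (subst (asm) nn_integral_0_iff_AE) auto
  then show ?thesis
  proof eventually_elim
    case (elim x)
    then have "s x = max a (min b (s x))"
      by (simp add: d_def)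
    then show ?case using ab by (auto simp: max_def min_def split: if_splits)
  qed
qed

section \<open>Orthonormality of the products of the coordinates\<close>

locale bernoulli_parameters =
  fixes p :: "nat \<Rightarrow> real"
  assumes p: "\<And>n. 0 < p n \<and> p n < 1"
begin

sublocale prob_space "bernoulli_space p"
  by (rule prob_space_bernoulli_space) (rule p)

lemma borel_measurable_sign_measure: "h \<in> borel_measurable (sign_measure a)"
  by (simp add: sign_measure_def)

lemma
  fixes h :: "real \<Rightarrow> real"
  shows integrable_\<zeta>: "integrable (bernoulli_space p) (\<lambda>\<omega>. h (\<zeta> n \<omega>))"
    and expectation_\<zeta>: "expectation (\<lambda>\<omega>. h (\<zeta> n \<omega>)) = p n * h 1 + (1 - p n) * h (-1)"
proof -
  have "integrable (sign_measure (p n)) h"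
    unfolding sign_measure_def by (rule integrable_point_measure_finite) simp
  then have "integrable (distr (bernoulli_space p) (sign_measure (p n)) (\<zeta> n)) h"
    by (simp add: distr_\<zeta> p)
  then show "integrable (bernoulli_space p) (\<lambda>\<omega>. h (\<zeta> n \<omega>))"
    by (rule integrable_distr[OF measurable_\<zeta>])
  have "expectation (\<lambda>\<omega>. h (\<zeta> n \<omega>))
      = integral\<^sup>L (distr (bernoulli_space p) (sign_measure (p n)) (\<zeta> n)) h"
    by (rule integral_distr[symmetric, OF measurable_\<zeta> borel_measurable_sign_measure])
  also have "\<dots> = integral\<^sup>L (sign_measure (p n)) h"
    by (simp add: distr_\<zeta> p)
  also have "\<dots> = p n * h 1 + (1 - p n) * h (-1)"
    unfolding sign_measure_def using p[of n]
    by (subst lebesgue_integral_point_measure_finite) auto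
  finally show "expectation (\<lambda>\<omega>. h (\<zeta> n \<omega>)) = p n * h 1 + (1 - p n) * h (-1)" .
qed

lemma
  fixes h :: "nat \<Rightarrow> real \<Rightarrow> real"
  assumes J: "finite J"
  shows integrable_prod_\<zeta>: "integrable (bernoulli_space p) (\<lambda>\<omega>. \<Prod>j\<in>J. h j (\<zeta> j \<omega>))"
    and expectation_prod_\<zeta>:
      "expectation (\<lambda>\<omega>. \<Prod>j\<in>J. h j (\<zeta> j \<omega>)) = (\<Prod>j\<in>J. expectation (\<lambda>\<omega>. h j (\<zeta> j \<omega>)))"
proof -
  have "indep_vars (\<lambda>_. borel) (\<lambda>j \<omega>. h j (\<zeta> j \<omega>)) UNIV"
    by (rule indep_vars_compose2[OF indep_vars_\<zeta>[OF p] borel_measurable_sign_measure])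
  then have ind: "indep_vars (\<lambda>_. borel) (\<lambda>j \<omega>. h j (\<zeta> j \<omega>)) J"
    by (rule indep_vars_subset) simp
  show "integrable (bernoulli_space p) (\<lambda>\<omega>. \<Prod>j\<in>J. h j (\<zeta> j \<omega>))"
    by (rule indep_vars_integrable[OF J ind integrable_\<zeta>])
  show "expectation (\<lambda>\<omega>. \<Prod>j\<in>J. h j (\<zeta> j \<omega>)) = (\<Prod>j\<in>J. expectation (\<lambda>\<omega>. h j (\<zeta> j \<omega>)))"
    by (rule indep_vars_lebesgue_integral[OF J ind integrable_\<zeta>])
qed

text \<open>The affine function through which \<open>Z\<^sub>n\<close> factors over \<open>\<zeta>\<^sub>n\<close>. With it, the mean
  of an expression in \<open>Z\<^sub>n\<close> alone becomes a sum over the two points \<open>1\<close> and \<open>-1\<close>.\<close>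

definition z :: "nat \<Rightarrow> real \<Rightarrow> real" where
  "z n x = (x + (1 - p n) - p n) / (2 * sqrt (p n * (1 - p n)))"

lemma Z_eq: "Z p n \<omega> = z n (\<zeta> n \<omega>)"
  by (simp add: Z_def z_def Let_def)

lemma
  shows z_sq: "(z n 1)\<^sup>2 = (1 - p n) / p n" "(z n (-1))\<^sup>2 = p n / (1 - p n)"
    and z_cross: "z n 1 * z n (-1) = -1"
    and z_mean: "p n * z n 1 + (1 - p n) * z n (-1) = 0"
proof -
  have r: "(sqrt (p n * (1 - p n)))\<^sup>2 = p n * (1 - p n)" "sqrt (p n * (1 - p n)) \<noteq> 0"
    using p[of n] by auto
  show "(z n 1)\<^sup>2 = (1 - p n) / p n" "(z n (-1))\<^sup>2 = p n / (1 - p n)"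
    unfolding z_def power_divide power_mult_distrib r(1) using p[of n]
    by (simp_all add: divide_simps) (simp_all add: power2_eq_square algebra_simps)
  have "z n 1 * z n (-1) = (2 * (1 - p n)) * (- 2 * p n) / (2 * sqrt (p n * (1 - p n)))\<^sup>2"
    unfolding z_def power2_eq_square times_divide_times_eq by simp
  then show "z n 1 * z n (-1) = -1"
    unfolding power_mult_distrib r(1) using p[of n] by (simp add: divide_simps)
  show "p n * z n 1 + (1 - p n) * z n (-1) = 0"
    using r(2) unfolding z_def by (simp add: divide_simps)
qed

text \<open>A product over the common index set \<open>\<sigma> \<union> \<tau>\<close>, each factor depending on one coordinate only, is
  the form to which independence applies.\<close>

lemma Zprod_mult_eq:
  assumes "finite \<sigma>" "finite \<tau>"
  shows "Zprod p \<sigma> \<omega> * Zprod p \<tau> \<omega>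
    = (\<Prod>j\<in>\<sigma> \<union> \<tau>. (if j \<in> \<sigma> then z j (\<zeta> j \<omega>) else 1) * (if j \<in> \<tau> then z j (\<zeta> j \<omega>) else 1))"
proof -
  have "Zprod p \<sigma> \<omega> = (\<Prod>j\<in>\<sigma> \<union> \<tau>. if j \<in> \<sigma> then z j (\<zeta> j \<omega>) else 1)"
    unfolding Zprod_def Z_eq using assms by (intro prod.mono_neutral_cong_left) auto
  moreover have "Zprod p \<tau> \<omega> = (\<Prod>j\<in>\<sigma> \<union> \<tau>. if j \<in> \<tau> then z j (\<zeta> j \<omega>) else 1)"
    unfolding Zprod_def Z_eq using assms by (intro prod.mono_neutral_cong_left) auto
  ultimately show ?thesis by (simp add: prod.distrib)
qed

lemma Zprod_L2:
  assumes "finite \<sigma>"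
  shows "Zprod p \<sigma> \<in> L2 (bernoulli_space p)"
proof -
  have "(\<lambda>\<omega>. (Zprod p \<sigma> \<omega>)\<^sup>2) = (\<lambda>\<omega>. \<Prod>j\<in>\<sigma>. (z j (\<zeta> j \<omega>))\<^sup>2)"
    by (auto simp: Zprod_def Z_eq prod_power_distrib)
  moreover have "Zprod p \<sigma> = (\<lambda>\<omega>. \<Prod>j\<in>\<sigma>. z j (\<zeta> j \<omega>))"
    by (auto simp: Zprod_def Z_eq)
  ultimately show ?thesis
    using integrable_prod_\<zeta>[OF assms, of z] integrable_prod_\<zeta>[OF assms, of "\<lambda>j x. (z j x)\<^sup>2"]
    by (auto simp: L2_def)
qed

text \<open>By independence the inner product of \<open>Z\<^sub>\<sigma>\<close> and \<open>Z\<^sub>\<tau>\<close> is a product over \<open>\<sigma> \<union> \<tau>\<close>, with a factor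
  \<open>E[Z\<^sub>j\<^sup>2] = 1\<close> for each common index and a factor \<open>E[Z\<^sub>j] = 0\<close> for every other one.\<close>

lemma Zprod_orthonormal: "orthonormal_family (bernoulli_space p) (Zprod p) \<Gamma>"
proof -
  have "L2_inner (bernoulli_space p) (Zprod p \<sigma>) (Zprod p \<tau>) = (if \<sigma> = \<tau> then 1 else 0)"
    if fin: "finite \<sigma>" "finite \<tau>" for \<sigma> \<tau>
  proof -
    define h where "h j x = (if j \<in> \<sigma> then z j x else 1) * (if j \<in> \<tau> then z j x else 1)" for j x
    have "L2_inner (bernoulli_space p) (Zprod p \<sigma>) (Zprod p \<tau>)
        = expectation (\<lambda>\<omega>. \<Prod>j\<in>\<sigma> \<union> \<tau>. h j (\<zeta> j \<omega>))"
      by (simp add: L2_inner_def h_def Zprod_mult_eq fin)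
    also have "\<dots> = (\<Prod>j\<in>\<sigma> \<union> \<tau>. p j * h j 1 + (1 - p j) * h j (-1))"
      using fin by (simp add: expectation_prod_\<zeta> expectation_\<zeta>)
    also have "\<dots> = (\<Prod>j\<in>\<sigma> \<union> \<tau>. if j \<in> \<sigma> \<longleftrightarrow> j \<in> \<tau> then 1 else 0)"
    proof (intro prod.cong refl)
      fix j assume "j \<in> \<sigma> \<union> \<tau>"
      moreover have "p j * (z j 1 * z j 1) + (1 - p j) * (z j (-1) * z j (-1)) = 1"
        using p[of j] z_sq[of j] by (simp add: power2_eq_square)
      ultimately show "p j * h j 1 + (1 - p j) * h j (-1) = (if j \<in> \<sigma> \<longleftrightarrow> j \<in> \<tau> then 1 else 0)"
        using z_mean[of j] by (auto simp: h_def)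
    qed
    also have "\<dots> = (if \<sigma> = \<tau> then 1 else 0)"
      using fin by (auto intro!: prod_zero prod.neutral)
    finally show ?thesis .
  qed
  then show ?thesis
    by (simp add: orthonormal_family_def \<Gamma>_def Zprod_L2)
qed

lemma expectation_Zprod:
  assumes "finite \<sigma>"
  shows "expectation (Zprod p \<sigma>) = (if \<sigma> = {} then 1 else 0)"
proof -
  have "L2_inner (bernoulli_space p) (Zprod p \<sigma>) (Zprod p {}) = (if \<sigma> = {} then 1 else 0)"
    using Zprod_orthonormal assms unfolding orthonormal_family_def \<Gamma>_def by blast
  then show ?thesis
    by (simp add: L2_inner_def Zprod_def[of p "{}"])
qed

section \<open>The finite-dimensional Mehler kernel\<close>

text \<open>The kernel of the semigroup on functions of the coordinates in \<open>J\<close>, in its factorised form. The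
  numbers \<open>r\<^sub>j\<close> play the role of \<open>exp (-t w\<^sub>j)\<close>, the correlation retained by coordinate \<open>j\<close> after
  time \<open>t\<close>.\<close>

definition mehler_kernel ::
    "(nat \<Rightarrow> real) \<Rightarrow> nat set \<Rightarrow> (nat \<Rightarrow> real) \<Rightarrow> (nat \<Rightarrow> real) \<Rightarrow> real" where
  "mehler_kernel r J \<omega> \<eta> = (\<Prod>j\<in>J. 1 + r j * (Z p j \<omega> * Z p j \<eta>))"

lemma mehler_kernel_expand:
  assumes "finite J"
  shows "mehler_kernel r J \<omega> \<eta> = (\<Sum>\<sigma>\<in>Pow J. prod r \<sigma> * Zprod p \<sigma> \<omega> * Zprod p \<sigma> \<eta>)"
proof -
  have "mehler_kernel r J \<omega> \<eta> = (\<Prod>j\<in>J. r j * (Z p j \<omega> * Z p j \<eta>) + 1)"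
    by (simp add: mehler_kernel_def add.commute)
  also have "\<dots> = (\<Sum>\<sigma>\<in>Pow J. (\<Prod>j\<in>\<sigma>. r j * (Z p j \<omega> * Z p j \<eta>)))"
    by (subst prod_add[OF assms]) simp
  finally show ?thesis
    by (simp add: Zprod_def prod.distrib mult.assoc)
qed

text \<open>If \<open>\<omega>\<close> and \<open>\<eta>\<close> agree at \<open>j\<close>, then \<open>Z\<^sub>j(\<omega>) Z\<^sub>j(\<eta>)\<close> is a square; otherwise it equals \<open>-1\<close>,
  whatever the value of \<open>p\<^sub>j\<close>.\<close>

lemma mehler_kernel_nonneg:
  assumes r: "\<And>j. 0 \<le> r j \<and> r j \<le> 1"
    and \<omega>: "\<omega> \<in> space (bernoulli_space p)" and \<eta>: "\<eta> \<in> space (bernoulli_space p)"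
  shows "0 \<le> mehler_kernel r J \<omega> \<eta>"
  unfolding mehler_kernel_def
proof (rule prod_nonneg)
  fix j
  have sgn: "\<omega> j = 1 \<or> \<omega> j = -1" "\<eta> j = 1 \<or> \<eta> j = -1"
    using \<omega> \<eta> by (auto simp: space_bernoulli_space)
  have "z j 1 * z j (-1) = -1" "z j (-1) * z j 1 = -1"
    using z_cross[of j] by (simp_all add: mult.commute)
  moreover have "-1 \<le> z j x * z j x" for x
    using zero_le_square[of "z j x"] by linarith
  ultimately have "-1 \<le> Z p j \<omega> * Z p j \<eta>"
    using sgn by (auto simp: Z_eq \<zeta>_def)
  then have "r j * (-1) \<le> r j * (Z p j \<omega> * Z p j \<eta>)"
    using r by (intro mult_left_mono) auto
  then show "0 \<le> 1 + r j * (Z p j \<omega> * Z p j \<eta>)"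
    using r[of j] by linarith
qed

lemma
  assumes J: "finite J"
  shows integrable_mehler_kernel: "integrable (bernoulli_space p) (mehler_kernel r J \<omega>)"
    and expectation_mehler_kernel: "expectation (mehler_kernel r J \<omega>) = 1"
proof -
  have eq: "mehler_kernel r J \<omega> = (\<lambda>\<eta>. \<Sum>\<sigma>\<in>Pow J. (prod r \<sigma> * Zprod p \<sigma> \<omega>) * Zprod p \<sigma> \<eta>)"
    using J by (simp add: mehler_kernel_expand fun_eq_iff)
  have int: "integrable (bernoulli_space p) (Zprod p \<sigma>)" if "\<sigma> \<in> Pow J" for \<sigma>
    using integrable_prod_\<zeta>[of \<sigma> z] that J finite_subset[of \<sigma> J]
    by (auto simp: Zprod_def[abs_def] Z_eq)
  then show "integrable (bernoulli_space p) (mehler_kernel r J \<omega>)"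
    unfolding eq by (intro Bochner_Integration.integrable_sum integrable_mult_right) auto
  have "expectation (mehler_kernel r J \<omega>)
      = (\<Sum>\<sigma>\<in>Pow J. (prod r \<sigma> * Zprod p \<sigma> \<omega>) * expectation (Zprod p \<sigma>))"
    unfolding eq using int by simp
  also have "\<dots> = (\<Sum>\<sigma>\<in>Pow J. if \<sigma> = {} then 1 else 0)"
    using J by (intro sum.cong refl) (auto simp: expectation_Zprod finite_subset Zprod_def)
  also have "\<dots> = 1"
    using J by simp
  finally show "expectation (mehler_kernel r J \<omega>) = 1" .
qed

text \<open>The partial sum is the integral of \<open>\<xi>\<close> against a probability density, the Mehler kernel.\<close>

lemma damped_partial_sum_bounds:
  assumes r: "\<And>j. 0 \<le> r j \<and> r j \<le> 1" and J: "finite J"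
    and \<xi>: "\<xi> \<in> L2 (bernoulli_space p)"
    and bnd: "AE \<eta> in bernoulli_space p. 0 \<le> \<xi> \<eta> \<and> \<xi> \<eta> \<le> 1"
    and \<omega>: "\<omega> \<in> space (bernoulli_space p)"
  defines "S \<equiv> \<Sum>\<sigma>\<in>Pow J. prod r \<sigma> * L2_inner (bernoulli_space p) (Zprod p \<sigma>) \<xi> * Zprod p \<sigma> \<omega>"
  shows "0 \<le> S \<and> S \<le> 1"
proof -
  have int: "integrable (bernoulli_space p) (\<lambda>\<eta>. Zprod p \<sigma> \<eta> * \<xi> \<eta>)" if "\<sigma> \<in> Pow J" for \<sigma>
  proof -
    have "finite \<sigma>"
      using that J by (auto intro: finite_subset)
    then show ?thesis
      by (rule L2_mult_integrable[OF Zprod_L2 \<xi>])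
  qed
  have eq: "mehler_kernel r J \<omega> \<eta> * \<xi> \<eta>
      = (\<Sum>\<sigma>\<in>Pow J. (prod r \<sigma> * Zprod p \<sigma> \<omega>) * (Zprod p \<sigma> \<eta> * \<xi> \<eta>))" for \<eta>
    using J by (simp add: mehler_kernel_expand sum_distrib_right mult.assoc)
  have int': "integrable (bernoulli_space p) (\<lambda>\<eta>. mehler_kernel r J \<omega> \<eta> * \<xi> \<eta>)"
    unfolding eq using int by (intro Bochner_Integration.integrable_sum integrable_mult_right) auto
  have "expectation (\<lambda>\<eta>. mehler_kernel r J \<omega> \<eta> * \<xi> \<eta>)
      = (\<Sum>\<sigma>\<in>Pow J. (prod r \<sigma> * Zprod p \<sigma> \<omega>) * expectation (\<lambda>\<eta>. Zprod p \<sigma> \<eta> * \<xi> \<eta>))"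
    unfolding eq using int by simp
  then have S: "S = expectation (\<lambda>\<eta>. mehler_kernel r J \<omega> \<eta> * \<xi> \<eta>)"
    by (simp add: S_def L2_inner_def ac_simps)
  have AE: "AE \<eta> in bernoulli_space p. 0 \<le> mehler_kernel r J \<omega> \<eta> * \<xi> \<eta> \<and>
      mehler_kernel r J \<omega> \<eta> * \<xi> \<eta> \<le> mehler_kernel r J \<omega> \<eta>"
    using bnd AE_space
  proof eventually_elim
    case (elim \<eta>)
    then show ?case
      using mehler_kernel_nonneg[of r \<omega> \<eta> J] r \<omega> by (auto intro: mult_left_le)
  qed
  have "0 \<le> S"
    unfolding S using AE by (intro integral_nonneg_AE) auto
  moreover have "S \<le> expectation (mehler_kernel r J \<omega>)"
    unfolding S using AE int' integrable_mehler_kernel[OF J] by (intro integral_mono_AE) auto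
  ultimately show ?thesis
    by (simp add: expectation_mehler_kernel[OF J])
qed

end

section \<open>The Markov property\<close>

lemma Pow_lessThan_subset_\<Gamma>: "Pow {..<n::nat} \<subseteq> \<Gamma>"
proof
  fix \<sigma> assume "\<sigma> \<in> Pow {..<n}"
  then show "\<sigma> \<in> \<Gamma>"
    using finite_subset[of \<sigma> "{..<n}"] by (simp add: \<Gamma>_def)
qed

text \<open>Finitely many finite sets of naturals have a common upper bound, so the families \<open>Pow {..<n}\<close> are
  cofinal.\<close>

lemma filterlim_Pow_lessThan:
  "filterlim (\<lambda>n. Pow {..<n}) (finite_subsets_at_top \<Gamma>) sequentially"
  unfolding filterlim_finite_subsets_at_top
proof (intro allI impI)
  fix X :: "nat set set"
  assume X: "finite X \<and> X \<subseteq> \<Gamma>"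
  then have "finite (\<Union>X)"
    by (auto simp: \<Gamma>_def)
  then obtain m where m: "\<Union>X \<subseteq> {..<m}"
    by (auto dest: finite_nat_bounded)
  have "finite (Pow {..<n}) \<and> X \<subseteq> Pow {..<n} \<and> Pow {..<n} \<subseteq> \<Gamma>" if "m \<le> n" for n
  proof (intro conjI)
    have "\<Union>X \<subseteq> {..<n}"
      using m lessThan_subset_iff[THEN iffD2, OF that] by (rule subset_trans)
    then show "X \<subseteq> Pow {..<n}"
      by (rule subset_trans[OF subset_Pow_Union Pow_mono])
  qed (simp_all add: Pow_lessThan_subset_\<Gamma>)
  then show "\<forall>\<^sub>F n in sequentially. finite (Pow {..<n}) \<and> X \<subseteq> Pow {..<n} \<and> Pow {..<n} \<subseteq> \<Gamma>"
    by (auto simp: eventually_sequentially)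
qed

theorem theorem5p1:
  fixes p w :: "nat \<Rightarrow> real"
  assumes "\<And>n. 0 < p n \<and> p n < 1"
    and "\<And>n. 0 \<le> w n"
  shows "\<forall>t\<ge>0. \<forall>\<xi>\<in>L2 (bernoulli_space p).
    (AE \<omega> in bernoulli_space p. 0 \<le> \<xi> \<omega> \<and> \<xi> \<omega> \<le> 1) \<longrightarrow>
    (AE \<omega> in bernoulli_space p. 0 \<le> OU p w t \<xi> \<omega> \<and> OU p w t \<xi> \<omega> \<le> 1)"
proof (intro allI ballI impI)
  fix t :: real and \<xi>
  assume t: "0 \<le> t" and \<xi>: "\<xi> \<in> L2 (bernoulli_space p)"
    and bnd: "AE \<omega> in bernoulli_space p. 0 \<le> \<xi> \<omega> \<and> \<xi> \<omega> \<le> 1"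
  interpret bernoulli_parameters p
    by standard (rule assms(1))
  define r where "r j = exp (- t * w j)" for j
  have r: "0 \<le> r j \<and> r j \<le> 1" for j
    using t assms(2) by (simp add: r_def)
  have prod_r: "exp (- t * wcount w \<sigma>) = prod r \<sigma>" if "finite \<sigma>" for \<sigma>
    using that by (simp add: r_def wcount_def sum_distrib_left flip: exp_sum sum_negf)
  define c where "c \<sigma> = exp (- t * wcount w \<sigma>) * L2_inner (bernoulli_space p) (Zprod p \<sigma>) \<xi>" for \<sigma>
  have "(\<lambda>\<sigma>. (c \<sigma>)\<^sup>2) summable_on \<Gamma>"
  proof (rule summable_on_comparison_test[OF bessel_summable[OF Zprod_orthonormal \<xi>]])
    fix \<sigma>
    have "0 \<le> t * wcount w \<sigma>"
      using t assms(2) by (simp add: wcount_def sum_nonneg)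
    then have "(exp (- t * wcount w \<sigma>))\<^sup>2 \<le> 1"
      by (simp add: power_le_one)
    then show "(c \<sigma>)\<^sup>2 \<le> (L2_inner (bernoulli_space p) (Zprod p \<sigma>) \<xi>)\<^sup>2"
      by (simp add: c_def power_mult_distrib mult_left_le_one_le)
  qed simp
  then obtain s where "L2_has_sum (bernoulli_space p) (\<lambda>\<sigma> \<omega>. c \<sigma> * Zprod p \<sigma> \<omega>) \<Gamma> s"
    by (rule riesz_fischer[OF Zprod_orthonormal])
  then have OU: "L2_has_sum (bernoulli_space p) (\<lambda>\<sigma> \<omega>. c \<sigma> * Zprod p \<sigma> \<omega>) \<Gamma> (OU p w t \<xi>)"
    unfolding OU_def c_def by (rule L2_has_sum_infsum)
  show "AE \<omega> in bernoulli_space p. 0 \<le> OU p w t \<xi> \<omega> \<and> OU p w t \<xi> \<omega> \<le> 1"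
  proof (rule L2_has_sum_AE_bounds[OF OU _ _ filterlim_Pow_lessThan])
    show "(\<lambda>\<omega>. c \<sigma> * Zprod p \<sigma> \<omega>) \<in> L2 (bernoulli_space p)" if "\<sigma> \<in> \<Gamma>" for \<sigma>
      using that by (intro L2_cmult Zprod_L2) (simp add: \<Gamma>_def)
    show "Pow {..<n} \<subseteq> \<Gamma>" for n :: nat
      by (rule Pow_lessThan_subset_\<Gamma>)
    fix n
    have "c \<sigma> = prod r \<sigma> * L2_inner (bernoulli_space p) (Zprod p \<sigma>) \<xi>" if "\<sigma> \<in> Pow {..<n}" for \<sigma>
    proof -
      have "finite \<sigma>"
        using that Pow_lessThan_subset_\<Gamma>[of n] unfolding \<Gamma>_def by blast
      then have "exp (- t * wcount w \<sigma>) = prod r \<sigma>"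
        by (rule prod_r)
      then show ?thesis
        by (simp only: c_def)
    qed
    then have "(\<Sum>\<sigma>\<in>Pow {..<n}. c \<sigma> * Zprod p \<sigma> \<omega>)
        = (\<Sum>\<sigma>\<in>Pow {..<n}. prod r \<sigma> * L2_inner (bernoulli_space p) (Zprod p \<sigma>) \<xi> * Zprod p \<sigma> \<omega>)" for \<omega>
      by (intro sum.cong refl) simp
    moreover have "0 \<le> S \<and> S \<le> 1"
      if "\<omega> \<in> space (bernoulli_space p)"
        and "S = (\<Sum>\<sigma>\<in>Pow {..<n}. prod r \<sigma> * L2_inner (bernoulli_space p) (Zprod p \<sigma>) \<xi> * Zprod p \<sigma> \<omega>)"
      for \<omega> S
      unfolding that(2) by (rule damped_partial_sum_bounds[OF r finite_lessThan \<xi> bnd that(1)])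
    ultimately show "AE \<omega> in bernoulli_space p. 0 \<le> (\<Sum>\<sigma>\<in>Pow {..<n}. c \<sigma> * Zprod p \<sigma> \<omega>) \<and>
        (\<Sum>\<sigma>\<in>Pow {..<n}. c \<sigma> * Zprod p \<sigma> \<omega>) \<le> 1"
      by (intro AE_I2) blast
  qed simp
qed

end
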